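(* Consider a particle in the $x,y$-plane moving, away from the line $\mathcal{L}=\{y=h\}$, according to Hamilton's equations for $$H=\frac{p_x^2+p_y^2}{2}-\frac{\alpha}{2r},\qquad r=\sqrt{x^2+y^2},\quad \alpha>0,$$ and reflected elastically each time it hits $\mathcal{L}$, at energy $\frac12 A$ with $A<0$. Let $a$ be the angular momentum of the particle, $e=\sqrt{1+\frac{4Aa^2}{\alpha^2}}$ the eccentricity and $\theta_0$ the angle of the aphelion of its current Kepler ellipse, $a_M=-\frac{\alpha}{2A}$ the semi-major axis, and $R_0$ the distance between the point $Q=(0,h)$ and the center of the current Kepler ellipse. Then the quantity $$R=a^2+h\,\alpha\, e\,\sin\theta_0\;\equiv\;\frac{\alpha}{2a_M}\left(h^2+a_M^2-R_0^2\right)$$ (the two expressions being identically equal) is a constant of motion: it is constant between collisions and takes the same value before and after each collision with $\mathcal{L}$.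
   Context: Here $h$ is a fixed real number; the line $\mathcal{L}=\{y=h\}$ is a hard wall and the attraction center is the origin $O=(0,0)$. An elastic reflection on $\mathcal{L}$ leaves the position and $p_x$ unchanged and maps $p_y$ to $-p_y$. The energy is written $H=\frac12A$, i.e. $A=p_x^2+p_y^2-\frac{\alpha}{r}$; it is conserved between collisions and by the collisions. The angular momentum is $a=x p_y-y p_x$. Between collisions, the particle moves on an arc of an ellipse (the current Kepler ellipse) having one focus at $O$, semi-major axis $a_M=-\frac{\alpha}{2A}$ and eccentricity $e=\sqrt{1+\frac{4Aa^2}{\alpha^2}}$; the angle $\theta_0$ is the angle that the aphelion of this ellipse (its point farthest from $O$), seen from $O$, makes with the positive $x$-axis, so that the center of the ellipse is $a_M e(\cos\theta_0,\sin\theta_0)$. (When $e=0$ the angle $\theta_0$ is arbitrary and irrelevant to the formula.) At a collision $A$ is unchanged, while $a$, $e$ and $\theta_0$ may change discontinuously. *)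

theory Defs
  imports "HOL-Analysis.Analysis"
begin

definition kepler_H :: "real \<Rightarrow> real \<Rightarrow> real \<Rightarrow> real \<Rightarrow> real \<Rightarrow> real" where
  "kepler_H \<alpha> x y px py = (px\<^sup>2 + py\<^sup>2) / 2 - \<alpha> / (2 * sqrt (x\<^sup>2 + y\<^sup>2))"

definition hamilton_equations_at ::
  "real \<Rightarrow> (real \<Rightarrow> real) \<Rightarrow> (real \<Rightarrow> real) \<Rightarrow> (real \<Rightarrow> real) \<Rightarrow> (real \<Rightarrow> real) \<Rightarrow> real \<Rightarrow> bool" where
  "hamilton_equations_at \<alpha> x y px py t \<longleftrightarrow>
     (x has_real_derivative deriv (\<lambda>u. kepler_H \<alpha> (x t) (y t) u (py t)) (px t)) (at t) \<and>
     (y has_real_derivative deriv (\<lambda>u. kepler_H \<alpha> (x t) (y t) (px t) u) (py t)) (at t) \<and>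
     (px has_real_derivative - deriv (\<lambda>u. kepler_H \<alpha> u (y t) (px t) (py t)) (x t)) (at t) \<and>
     (py has_real_derivative - deriv (\<lambda>u. kepler_H \<alpha> (x t) u (px t) (py t)) (y t)) (at t)"

definition free_times :: "real \<Rightarrow> real set \<Rightarrow> (real \<Rightarrow> real) \<Rightarrow> real set" where
  "free_times h T y = {t \<in> T. y t \<noteq> h}"

text \<open>A motion on the open time interval \<^term>\<open>T\<close> with wall \<open>y = h\<close>. Hits of the wall are isolated,
  so together with continuity they are locally finite in \<^term>\<open>T\<close>. At a hit only the one-sided limits
  of the momentum matter; the values of \<^term>\<open>px\<close> and \<^term>\<open>py\<close> at the hit itself are irrelevant.
  Grazing contact (\<open>my = 0\<close>) is allowed.\<close>
definition billiard_motion ::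
  "real \<Rightarrow> real \<Rightarrow> real set \<Rightarrow> (real \<Rightarrow> real) \<Rightarrow> (real \<Rightarrow> real) \<Rightarrow> (real \<Rightarrow> real) \<Rightarrow> (real \<Rightarrow> real) \<Rightarrow> bool" where
  "billiard_motion \<alpha> h T x y px py \<longleftrightarrow>
     open T \<and> is_interval T \<and>
     continuous_on T x \<and> continuous_on T y \<and>
     (\<forall>t\<in>T. (x t, y t) \<noteq> (0, 0)) \<and>
     (\<forall>t\<in>T. y t \<noteq> h \<longrightarrow> hamilton_equations_at \<alpha> x y px py t) \<and>
     (\<forall>t\<in>T. y t = h \<longrightarrow>
        (\<forall>\<^sub>F s in at t. y s \<noteq> h) \<and>
        (\<exists>mx my. (px \<longlongrightarrow> mx) (at_left t) \<and> (px \<longlongrightarrow> mx) (at_right t) \<and>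
                 (py \<longlongrightarrow> my) (at_left t) \<and> (py \<longlongrightarrow> - my) (at_right t)))"

definition angular_momentum :: "real \<Rightarrow> real \<Rightarrow> real \<Rightarrow> real \<Rightarrow> real" where
  "angular_momentum x y px py = x * py - y * px"

definition semi_major :: "real \<Rightarrow> real \<Rightarrow> real" where
  "semi_major \<alpha> A = - \<alpha> / (2 * A)"

definition eccentricity :: "real \<Rightarrow> real \<Rightarrow> real \<Rightarrow> real" where
  "eccentricity \<alpha> A a = sqrt (1 + 4 * A * a\<^sup>2 / \<alpha>\<^sup>2)"

text \<open>The ellipse with one focus at the origin, centre \<^term>\<open>c\<close> (hence second focus \<open>2c\<close>) and
  semi-major axis \<^term>\<open>s\<close>; its eccentricity is \<open>norm c / s\<close>. For \<open>norm c = s\<close> it degenerates to the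
  segment from the origin to \<open>2c\<close>, which is the radial case of zero angular momentum.\<close>
definition ellipse_focus_origin :: "real \<Rightarrow> real \<times> real \<Rightarrow> (real \<times> real) set" where
  "ellipse_focus_origin s c = {P. dist P 0 + dist P (2 *\<^sub>R c) = 2 * s}"

text \<open>Centre of the current Kepler ellipse at a collision-free time \<^term>\<open>t\<close>: the ellipse with a focus
  at the origin, the prescribed semi-major axis and eccentricity, which contains the whole arc
  travelled between the collisions preceding and following \<^term>\<open>t\<close>.\<close>
definition kepler_centre ::
  "real \<Rightarrow> real \<Rightarrow> real \<Rightarrow> real set \<Rightarrow> (real \<Rightarrow> real) \<Rightarrow> (real \<Rightarrow> real) \<Rightarrow> (real \<Rightarrow> real) \<Rightarrow> (real \<Rightarrow> real)
    \<Rightarrow> real \<Rightarrow> real \<times> real" where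
  "kepler_centre \<alpha> A h T x y px py t = (THE c.
     norm c = semi_major \<alpha> A * eccentricity \<alpha> A (angular_momentum (x t) (y t) (px t) (py t)) \<and>
     (\<forall>s \<in> connected_component_set (free_times h T y) t.
        (x s, y s) \<in> ellipse_focus_origin (semi_major \<alpha> A) c))"

definition kepler_ellipse ::
  "real \<Rightarrow> real \<Rightarrow> real \<Rightarrow> real set \<Rightarrow> (real \<Rightarrow> real) \<Rightarrow> (real \<Rightarrow> real) \<Rightarrow> (real \<Rightarrow> real) \<Rightarrow> (real \<Rightarrow> real)
    \<Rightarrow> real \<Rightarrow> (real \<times> real) set" where
  "kepler_ellipse \<alpha> A h T x y px py t =
     ellipse_focus_origin (semi_major \<alpha> A) (kepler_centre \<alpha> A h T x y px py t)"

text \<open>For a circle every angle qualifies.\<close>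
definition is_aphelion_angle :: "(real \<times> real) set \<Rightarrow> real \<Rightarrow> bool" where
  "is_aphelion_angle E \<theta> \<longleftrightarrow>
     (\<exists>P\<in>E. (\<forall>P'\<in>E. dist P' 0 \<le> dist P 0) \<and> P = dist P 0 *\<^sub>R (cos \<theta>, sin \<theta>))"

end

theory Submission imports Defs begin

text \<open>The centre of the current Kepler ellipse is \<open>c = L / A\<close> with \<open>L\<close> the
  Laplace--Runge--Lenz vector, which gives \<open>R = a\<^sup>2 - 2 h L\<^sub>y\<close> for both expressions. Between
  collisions \<open>a\<close> and \<open>L\<close> are conserved. On the wall \<open>y = h\<close> one computes
  \<open>R = x\<^sup>2 p\<^sub>y\<^sup>2 - h\<^sup>2 p\<^sub>x\<^sup>2 + \<alpha> h\<^sup>2 / r\<close>, which is even in \<open>p\<^sub>y\<close>, so a reflection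
  does not change it.\<close>

section \<open>Ellipses with a focus at the origin and the direction of their aphelion\<close>

text \<open>Isolating the distance to the second focus and squaring cancels the quadratic terms in
  \<open>P\<close>, which leaves the focal equation, linear in \<open>P\<close> and
  \<open>norm P\<close>. The bound \<open>norm P \<le> 2 * s\<close> is what makes the squaring
  reversible.\<close>

lemma ellipse_focus_origin_iff:
  "P \<in> ellipse_focus_origin s c \<longleftrightarrow> norm P \<le> 2 * s \<and> s\<^sup>2 - (norm c)\<^sup>2 = s * norm P - P \<bullet> c"
proof -
  have d: "(dist P (2 *\<^sub>R c))\<^sup>2 = (norm P)\<^sup>2 - 4 * (P \<bullet> c) + 4 * (norm c)\<^sup>2"
    by (simp add: dist_norm power2_norm_eq_inner inner_diff_left inner_diff_right inner_commute
        power_mult_distrib)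
  have "P \<in> ellipse_focus_origin s c \<longleftrightarrow> dist P (2 *\<^sub>R c) = 2 * s - norm P"
    by (auto simp: ellipse_focus_origin_def)
  also have "\<dots> \<longleftrightarrow> norm P \<le> 2 * s \<and> (dist P (2 *\<^sub>R c))\<^sup>2 = (2 * s - norm P)\<^sup>2"
    by (metis diff_ge_0_iff_ge power2_eq_iff_nonneg zero_le_dist)
  also have "\<dots> \<longleftrightarrow> norm P \<le> 2 * s \<and> s\<^sup>2 - (norm c)\<^sup>2 = s * norm P - P \<bullet> c"
    unfolding d by (auto simp: power2_eq_square algebra_simps)
  finally show ?thesis .
qed

text \<open>The triangle inequality through the second focus bounds the distance to the origin by
  \<open>s + norm c\<close>. The bound is attained on the ray spanned by \<open>c\<close>, and any
  point that attains it satisfies the equality case of Cauchy-Schwarz with \<open>c\<close>, so it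
  lies on that ray. For \<open>c = 0\<close> nothing has to be shown about the angle.\<close>

lemma aphelion_angle_centre:
  fixes c :: "real \<times> real"
  assumes "norm c \<le> s" and "is_aphelion_angle (ellipse_focus_origin s c) \<theta>"
  shows "c = norm c *\<^sub>R (cos \<theta>, sin \<theta>)"
proof (cases "c = 0")
  case False
  obtain P where P: "P \<in> ellipse_focus_origin s c"
    and max: "\<forall>P'\<in>ellipse_focus_origin s c. dist P' 0 \<le> dist P 0"
    and P_eq: "P = dist P 0 *\<^sub>R (cos \<theta>, sin \<theta>)"
    using assms(2) unfolding is_aphelion_angle_def by blast
  \<comment> \<open>\<open>Q\<close> is the aphelion itself: the point at distance
    \<open>s + norm c\<close> on the ray of \<open>c\<close>. It forces the maximum in the
    definition of the aphelion angle to be at least this large.\<close>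
  define Q where "Q = ((s + norm c) / norm c) *\<^sub>R c"
  have nQ: "norm Q = s + norm c" and Qc: "Q \<bullet> c = (s + norm c) * norm c"
    using False assms(1) order_trans[OF norm_ge_zero[of c] assms(1)]
    by (auto simp: Q_def dot_square_norm power2_eq_square)
  have "Q \<in> ellipse_focus_origin s c"
    unfolding ellipse_focus_origin_iff nQ Qc using assms(1)
    by (auto simp: power2_eq_square algebra_simps)
  then have ge: "s + norm c \<le> norm P" using max nQ by force
  have "norm P \<le> dist P (2 *\<^sub>R c) + norm (2 *\<^sub>R c)"
    by (metis dist_norm norm_triangle_sub add.commute)
  then have "norm P \<le> s + norm c"
    using P by (auto simp: ellipse_focus_origin_def)
  with ge have nP: "norm P = s + norm c" by simp
  \<comment> \<open>With \<open>norm P = s + norm c\<close> the focal equation becomes equality in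
    Cauchy-Schwarz.\<close>
  have "P \<bullet> c = norm P * norm c"
    using P unfolding ellipse_focus_origin_iff nP by (auto simp: power2_eq_square algebra_simps)
  then have "norm P *\<^sub>R c = norm c *\<^sub>R P"
    by (simp add: norm_cauchy_schwarz_eq)
  also have "\<dots> = norm P *\<^sub>R (norm c *\<^sub>R (cos \<theta>, sin \<theta>))"
    by (subst P_eq) (simp add: mult.commute mult.left_commute)
  finally have "norm P *\<^sub>R c = norm P *\<^sub>R (norm c *\<^sub>R (cos \<theta>, sin \<theta>))" .
  moreover have "norm P \<noteq> 0"
    using nP False assms(1) by (smt (verit) norm_ge_zero zero_less_norm_iff)
  ultimately show ?thesis by (simp only: real_vector.scale_cancel_left) simp
qed (simp add: zero_prod_def)

section \<open>The Laplace-Runge-Lenz vector and the ellipse it determines\<close>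

text \<open>The Laplace--Runge--Lenz vector. It points to the perihelion and has norm \<open>\<alpha> e / 2\<close>, so the
  centre of the Kepler ellipse is this vector divided by \<open>A\<close>.\<close>
definition lrl :: "real \<Rightarrow> real \<Rightarrow> real \<Rightarrow> real \<Rightarrow> real \<Rightarrow> real \<times> real" where
  "lrl \<alpha> x y px py =
     (py * angular_momentum x y px py - \<alpha> / 2 * x / sqrt (x\<^sup>2 + y\<^sup>2),
      - px * angular_momentum x y px py - \<alpha> / 2 * y / sqrt (x\<^sup>2 + y\<^sup>2))"

text \<open>In the expanded square the cross term is \<open>- \<alpha> * a\<^sup>2 / r\<close>, with
  \<open>a\<close> the angular momentum. It combines with
  \<open>a\<^sup>2 * (px\<^sup>2 + py\<^sup>2)\<close> to \<open>A * a\<^sup>2\<close>, by the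
  energy relation.\<close>

lemma power2_norm_lrl:
  assumes "(x, y) \<noteq> (0, 0)" and "kepler_H \<alpha> x y px py = A / 2"
  shows "(norm (lrl \<alpha> x y px py))\<^sup>2 = A * (angular_momentum x y px py)\<^sup>2 + \<alpha>\<^sup>2 / 4"
proof -
  define r where "r = sqrt (x\<^sup>2 + y\<^sup>2)"
  define a where "a = angular_momentum x y px py"
  have r2: "r\<^sup>2 = x\<^sup>2 + y\<^sup>2" and r0: "r > 0"
    using assms(1) by (auto simp: r_def sum_power2_gt_zero_iff)
  have A: "A = px\<^sup>2 + py\<^sup>2 - \<alpha> / r"
    using assms(2) unfolding kepler_H_def r_def[symmetric] using r0 by (simp add: field_simps)
  have "(norm (lrl \<alpha> x y px py))\<^sup>2 = (py * a - \<alpha> / 2 * x / r)\<^sup>2 + (- px * a - \<alpha> / 2 * y / r)\<^sup>2"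
    by (simp add: lrl_def norm_prod_def r_def a_def)
  also have "\<dots> = a\<^sup>2 * (px\<^sup>2 + py\<^sup>2) - \<alpha> * a * (x * py - y * px) / r + \<alpha>\<^sup>2 / 4 * ((x\<^sup>2 + y\<^sup>2) / r\<^sup>2)"
    using r0 by (simp add: power2_eq_square field_simps)
  also have "\<dots> = a\<^sup>2 * (px\<^sup>2 + py\<^sup>2) - \<alpha> * a * a / r + \<alpha>\<^sup>2 / 4"
    using r0 by (simp add: r2[symmetric] a_def angular_momentum_def)
  also have "\<dots> = A * a\<^sup>2 + \<alpha>\<^sup>2 / 4"
    unfolding A by (simp add: power2_eq_square algebra_simps)
  finally show ?thesis by (simp add: a_def)
qed

text \<open>The product of \<open>(x, y)\<close> with \<open>(py, - px)\<close> is again the angular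
  momentum, whence its square. Divided by \<open>A\<close>, this identity becomes the focal equation
  of the orbit.\<close>

lemma inner_lrl:
  assumes "(x, y) \<noteq> (0, 0)"
  shows "(x, y) \<bullet> lrl \<alpha> x y px py = (angular_momentum x y px py)\<^sup>2 - \<alpha> / 2 * norm (x, y)"
proof -
  define r where "r = sqrt (x\<^sup>2 + y\<^sup>2)"
  have r2: "x\<^sup>2 + y\<^sup>2 = r\<^sup>2" and r0: "r > 0"
    using assms(1) by (auto simp: r_def sum_power2_gt_zero_iff)
  have "(x, y) \<bullet> lrl \<alpha> x y px py
      = (angular_momentum x y px py) * (x * py - y * px) - \<alpha> / 2 * ((x\<^sup>2 + y\<^sup>2) / r)"
    unfolding lrl_def r_def[symmetric] using r0 by (simp add: power2_eq_square field_simps)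
  also have "\<dots> = (angular_momentum x y px py)\<^sup>2 - \<alpha> / 2 * r"
    unfolding r2 by (simp add: angular_momentum_def power2_eq_square)
  finally show ?thesis by (simp add: r_def norm_prod_def)
qed

lemma norm_centre:
  assumes "\<alpha> > 0" "A < 0" "(x, y) \<noteq> (0, 0)" "kepler_H \<alpha> x y px py = A / 2"
  shows "norm ((1 / A) *\<^sub>R lrl \<alpha> x y px py)
    = semi_major \<alpha> A * eccentricity \<alpha> A (angular_momentum x y px py)"
proof -
  let ?a = "angular_momentum x y px py"
  \<comment> \<open>The radicand of the eccentricity is exhibited as the square of a nonnegative
    number, so the root can be taken directly.\<close>
  have "1 + 4 * A * ?a\<^sup>2 / \<alpha>\<^sup>2 = (2 / \<alpha> * norm (lrl \<alpha> x y px py))\<^sup>2"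
    unfolding power_mult_distrib power2_norm_lrl[OF assms(3,4)] using assms(1)
    by (simp add: field_simps)
  then have "eccentricity \<alpha> A ?a = 2 / \<alpha> * norm (lrl \<alpha> x y px py)"
    unfolding eccentricity_def using assms(1) by simp
  then show ?thesis using assms(1,2) by (simp add: semi_major_def)
qed

lemma eccentricity_le_1:
  assumes "A < 0" shows "eccentricity \<alpha> A a \<le> 1"
  using assms unfolding eccentricity_def
  by (simp add: divide_nonpos_nonneg mult_nonpos_nonneg)

text \<open>This is the square of the semi-minor axis: the terms
  \<open>\<alpha>\<^sup>2 / (4 * A\<^sup>2)\<close> of the two squares cancel.\<close>

lemma semi_major_power_diff:
  assumes "A < 0" "(x, y) \<noteq> (0, 0)" "kepler_H \<alpha> x y px py = A / 2"
  shows "(semi_major \<alpha> A)\<^sup>2 - (norm ((1 / A) *\<^sub>R lrl \<alpha> x y px py))\<^sup>2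
    = - (angular_momentum x y px py)\<^sup>2 / A"
proof -
  have "(norm ((1 / A) *\<^sub>R lrl \<alpha> x y px py))\<^sup>2 = (norm (lrl \<alpha> x y px py))\<^sup>2 / A\<^sup>2"
    by (simp add: power_divide)
  then show ?thesis
    unfolding power2_norm_lrl[OF assms(2,3)] semi_major_def using assms(1)
    by (simp add: field_simps power2_eq_square)
qed

text \<open>The two conditions of \<open>ellipse_focus_origin_iff\<close> have separate sources. The
  bound on the distance holds because the kinetic energy is nonnegative and \<open>A < 0\<close>;
  the focal equation is \<open>inner_lrl\<close> divided by \<open>A\<close>.\<close>

lemma mem_kepler_ellipse:
  assumes "\<alpha> > 0" "A < 0" "(x, y) \<noteq> (0, 0)" "kepler_H \<alpha> x y px py = A / 2"
  shows "(x, y) \<in> ellipse_focus_origin (semi_major \<alpha> A) ((1 / A) *\<^sub>R lrl \<alpha> x y px py)"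
  unfolding ellipse_focus_origin_iff semi_major_power_diff[OF assms(2-4)]
proof
  define r where "r = sqrt (x\<^sup>2 + y\<^sup>2)"
  have r0: "r > 0"
    using assms(3) by (auto simp: r_def sum_power2_gt_zero_iff)
  have "\<alpha> / r = px\<^sup>2 + py\<^sup>2 - A"
    using assms(4) unfolding kepler_H_def r_def[symmetric] using r0 by (simp add: field_simps)
  then have "- A \<le> \<alpha> / r" by simp
  then have "r \<le> - \<alpha> / A"
    using assms(2) r0 by (simp add: field_simps)
  then show "norm (x, y) \<le> 2 * semi_major \<alpha> A"
    by (simp add: norm_prod_def r_def semi_major_def)
  show "- (angular_momentum x y px py)\<^sup>2 / A
    = semi_major \<alpha> A * norm (x, y) - (x, y) \<bullet> (1 / A) *\<^sub>R lrl \<alpha> x y px py"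
    unfolding inner_scaleR_right inner_lrl[OF assms(3)] semi_major_def
    using assms(2) by (simp add: field_simps)
qed

section \<open>Conservation laws of the Kepler flow\<close>

lemma DERIV_norm:
  fixes f g :: "real \<Rightarrow> real"
  assumes "(f has_real_derivative f') (at t)" "(g has_real_derivative g') (at t)"
    and "(f t, g t) \<noteq> (0, 0)"
  shows "((\<lambda>t. sqrt ((f t)\<^sup>2 + (g t)\<^sup>2)) has_real_derivative
    (f t * f' + g t * g') / sqrt ((f t)\<^sup>2 + (g t)\<^sup>2)) (at t)"
proof -
  define r where "r = sqrt ((f t)\<^sup>2 + (g t)\<^sup>2)"
  have pos: "(f t)\<^sup>2 + (g t)\<^sup>2 > 0"
    using assms(3) by (auto simp: sum_power2_gt_zero_iff)
  have "((\<lambda>t. sqrt ((f t)\<^sup>2 + (g t)\<^sup>2)) has_real_derivative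
      inverse r / 2 * (2 * f t * f' + 2 * g t * g')) (at t)"
    unfolding r_def using pos by (auto intro!: derivative_eq_intros assms(1,2))
  moreover have "inverse r / 2 * (2 * f t * f' + 2 * g t * g') = (f t * f' + g t * g') / r"
  proof -
    have "r \<noteq> 0" using assms(3) by (simp add: r_def)
    then show ?thesis by (simp add: field_simps)
  qed
  ultimately show ?thesis by (simp only: r_def)
qed

text \<open>Stated along a curve so that it serves twice: with one coordinate constant it gives the
  partial derivatives in Hamilton's equations, and along the motion it gives the time derivative of
  the potential.\<close>

lemma DERIV_kepler_potential:
  fixes f g :: "real \<Rightarrow> real"
  assumes "(f has_real_derivative f') (at t)" "(g has_real_derivative g') (at t)"
    and "(f t, g t) \<noteq> (0, 0)"
  shows "((\<lambda>t. \<alpha> / (2 * sqrt ((f t)\<^sup>2 + (g t)\<^sup>2))) has_real_derivative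
    - \<alpha> / 2 * (f t * f' + g t * g') / sqrt ((f t)\<^sup>2 + (g t)\<^sup>2) ^ 3) (at t)"
proof -
  define r where "r = sqrt ((f t)\<^sup>2 + (g t)\<^sup>2)"
  have "r > 0" using assms(3) by (auto simp: r_def sum_power2_gt_zero_iff)
  then have "(0 * (2 * r) - \<alpha> * (2 * ((f t * f' + g t * g') / r))) / (2 * r * (2 * r))
      = - \<alpha> / 2 * (f t * f' + g t * g') / r ^ 3"
    by (simp add: field_simps power3_eq_cube)
  then show ?thesis
    using \<open>r > 0\<close> DERIV_divide[OF DERIV_const[of \<alpha>] DERIV_cmult[OF DERIV_norm[OF assms], of 2]]
    unfolding r_def[symmetric] by simp
qed

text \<open>Evaluating the partial derivatives of \<open>kepler_H\<close> turns Hamilton's equations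
  into Newton's equations for an inverse-square central force.\<close>

lemma hamilton_equations_derivs:
  assumes "(x t, y t) \<noteq> (0, 0)" and "hamilton_equations_at \<alpha> x y px py t"
  defines "r \<equiv> sqrt ((x t)\<^sup>2 + (y t)\<^sup>2)"
  shows "(x has_real_derivative px t) (at t)"
    and "(y has_real_derivative py t) (at t)"
    and "(px has_real_derivative - \<alpha> / 2 * x t / r ^ 3) (at t)"
    and "(py has_real_derivative - \<alpha> / 2 * y t / r ^ 3) (at t)"
proof -
  have "deriv (\<lambda>u. kepler_H \<alpha> (x t) (y t) u (py t)) (px t) = px t"
    unfolding kepler_H_def by (rule DERIV_imp_deriv) (auto intro!: derivative_eq_intros)
  moreover have "deriv (\<lambda>u. kepler_H \<alpha> (x t) (y t) (px t) u) (py t) = py t"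
    unfolding kepler_H_def by (rule DERIV_imp_deriv) (auto intro!: derivative_eq_intros)
  moreover have "deriv (\<lambda>u. kepler_H \<alpha> u (y t) (px t) (py t)) (x t) = \<alpha> / 2 * x t / r ^ 3"
    unfolding kepler_H_def r_def using assms(1)
    by (intro DERIV_imp_deriv)
      (rule derivative_eq_intros DERIV_kepler_potential refl | simp)+
  moreover have "deriv (\<lambda>u. kepler_H \<alpha> (x t) u (px t) (py t)) (y t) = \<alpha> / 2 * y t / r ^ 3"
    unfolding kepler_H_def r_def using assms(1)
    by (intro DERIV_imp_deriv)
      (rule derivative_eq_intros DERIV_kepler_potential refl | simp)+
  ultimately show "(x has_real_derivative px t) (at t)"
    and "(y has_real_derivative py t) (at t)"
    and "(px has_real_derivative - \<alpha> / 2 * x t / r ^ 3) (at t)"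
    and "(py has_real_derivative - \<alpha> / 2 * y t / r ^ 3) (at t)"
    using assms(2) unfolding hamilton_equations_at_def by auto
qed

text \<open>A central force preserves the angular momentum \<open>a\<close>. The unit radial vector
  then has derivative \<open>a / r ^ 3\<close> times \<open>(- y, x)\<close>, and
  \<open>\<alpha> / 2\<close> times this is exactly what the force contributes to \<open>a\<close>
  times \<open>(py, - px)\<close>; hence both components of \<open>lrl\<close> are
  stationary.\<close>

lemma kepler_conserved:
  assumes "(x t, y t) \<noteq> (0, 0)" and "hamilton_equations_at \<alpha> x y px py t"
  shows "((\<lambda>t. kepler_H \<alpha> (x t) (y t) (px t) (py t)) has_real_derivative 0) (at t)"
    and "((\<lambda>t. angular_momentum (x t) (y t) (px t) (py t)) has_real_derivative 0) (at t)"
    and "((\<lambda>t. fst (lrl \<alpha> (x t) (y t) (px t) (py t))) has_real_derivative 0) (at t)"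
    and "((\<lambda>t. snd (lrl \<alpha> (x t) (y t) (px t) (py t))) has_real_derivative 0) (at t)"
proof -
  define r where "r = sqrt ((x t)\<^sup>2 + (y t)\<^sup>2)"
  note D = hamilton_equations_derivs[OF assms, folded r_def]
  have pos: "(x t)\<^sup>2 + (y t)\<^sup>2 > 0"
    using assms(1) by (auto simp: sum_power2_gt_zero_iff)
  then have r0: "r > 0" and r2: "r\<^sup>2 = (x t)\<^sup>2 + (y t)\<^sup>2" by (auto simp: r_def)
  note dr = DERIV_norm[OF D(1,2) assms(1), folded r_def]
  show "((\<lambda>t. kepler_H \<alpha> (x t) (y t) (px t) (py t)) has_real_derivative 0) (at t)"
    unfolding kepler_H_def
    by (rule DERIV_cong[OF DERIV_diff[OF DERIV_cdivide[OF DERIV_add[OF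
              DERIV_power[OF D(3)] DERIV_power[OF D(4)]]] DERIV_kepler_potential[OF D(1,2) assms(1)]]])
      (use r0 in \<open>simp add: r_def[symmetric] field_simps\<close>)
  show a': "((\<lambda>t. angular_momentum (x t) (y t) (px t) (py t)) has_real_derivative 0) (at t)"
    unfolding angular_momentum_def using r0
    by (auto intro!: derivative_eq_intros D simp: field_simps)
  \<comment> \<open>First component of the rotating unit radial vector: after
    \<open>r\<^sup>2\<close> is expanded, the radial part of the velocity drops out and only the
    angular momentum remains.\<close>
  have dx: "((\<lambda>t. x t / sqrt ((x t)\<^sup>2 + (y t)\<^sup>2)) has_real_derivative
      - y t * angular_momentum (x t) (y t) (px t) (py t) / r ^ 3) (at t)"
  proof -
    have "(px t * r - x t * ((x t * px t + y t * py t) / r)) / (r * r)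
      = (px t * r\<^sup>2 - x t * (x t * px t + y t * py t)) / r ^ 3"
      using r0 by (simp add: field_simps power2_eq_square power3_eq_cube)
    also have "\<dots> = - y t * angular_momentum (x t) (y t) (px t) (py t) / r ^ 3"
      unfolding r2 by (simp add: angular_momentum_def algebra_simps power2_eq_square)
    finally show ?thesis
      using DERIV_divide[OF D(1) dr] r0 by (simp add: r_def[symmetric])
  qed
  have dy: "((\<lambda>t. y t / sqrt ((x t)\<^sup>2 + (y t)\<^sup>2)) has_real_derivative
      x t * angular_momentum (x t) (y t) (px t) (py t) / r ^ 3) (at t)"
  proof -
    have "(py t * r - y t * ((x t * px t + y t * py t) / r)) / (r * r)
      = (py t * r\<^sup>2 - y t * (x t * px t + y t * py t)) / r ^ 3"
      using r0 by (simp add: field_simps power2_eq_square power3_eq_cube)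
    also have "\<dots> = x t * angular_momentum (x t) (y t) (px t) (py t) / r ^ 3"
      unfolding r2 by (simp add: angular_momentum_def algebra_simps power2_eq_square)
    finally show ?thesis
      using DERIV_divide[OF D(2) dr] r0 by (simp add: r_def[symmetric])
  qed
  show "((\<lambda>t. fst (lrl \<alpha> (x t) (y t) (px t) (py t))) has_real_derivative 0) (at t)"
    unfolding lrl_def fst_conv times_divide_eq_right[symmetric]
    by (rule derivative_eq_intros D a' dx refl)+ simp
  show "((\<lambda>t. snd (lrl \<alpha> (x t) (y t) (px t) (py t))) has_real_derivative 0) (at t)"
    unfolding lrl_def snd_conv times_divide_eq_right[symmetric]
    by (rule derivative_eq_intros D a' dy refl)+ simp
qed

section \<open>Constancy across isolated hits of the wall\<close>

lemma DERIV_zero_const_on: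
  fixes f :: "real \<Rightarrow> real"
  assumes "connected S" "open S" "\<And>t. t \<in> S \<Longrightarrow> (f has_real_derivative 0) (at t)"
    and "s \<in> S" "t \<in> S"
  shows "f s = f t"
proof -
  have "f constant_on S"
    using assms by (intro has_field_derivative_0_imp_constant_on) auto
  then show ?thesis using assms(4,5) by (auto simp: constant_on_def)
qed

text \<open>Replacing the value of \<open>f\<close> at each hit by its two-sided limit gives a
  locally constant function on the connected set \<open>T\<close>. Nothing is assumed about
  \<open>f\<close> at the hit itself, because the momenta there are arbitrary.\<close>

lemma const_across_isolated:
  fixes f y :: "real \<Rightarrow> real"
  assumes "open T" "is_interval T" "continuous_on T y"
    and der: "\<And>t. t \<in> T \<Longrightarrow> y t \<noteq> h \<Longrightarrow> (f has_real_derivative 0) (at t)"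
    and iso: "\<And>t. t \<in> T \<Longrightarrow> y t = h \<Longrightarrow> \<forall>\<^sub>F s in at t. y s \<noteq> h"
    and lim: "\<And>t. t \<in> T \<Longrightarrow> y t = h \<Longrightarrow>
      \<exists>l. (f \<longlongrightarrow> l) (at_left t) \<and> (f \<longlongrightarrow> l) (at_right t)"
    and st: "s \<in> free_times h T y" "t \<in> free_times h T y"
  shows "f s = f t"
proof -
  define g where "g = (\<lambda>t. if y t = h then Lim (at t) f else f t)"
  have "g s = g t"
  proof (rule connected_local_const[where f = g and A = T])
    show "connected T" using assms(2) is_interval_connected_1 by blast
    show "\<forall>t\<in>T. \<forall>\<^sub>F s in at t within T. g t = g s"
    proof
      fix t assume t: "t \<in> T"
      have "\<forall>\<^sub>F s in at t. g t = g s"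
      proof (cases "y t = h")
        case False
        have "isCont y t" using assms(1,3) t continuous_on_eq_continuous_at by blast
        \<comment> \<open>The filter \<open>nhds t\<close> includes \<open>t\<close>, so a full ball
          around \<open>t\<close> is free of hits and \<open>f\<close> is constant on it.\<close>
        then have "\<forall>\<^sub>F s in nhds t. y s \<noteq> h"
          using False by (auto simp: isCont_def tendsto_at_iff_tendsto_nhds dest: tendsto_imp_eventually_ne)
        moreover have "\<forall>\<^sub>F s in nhds t. s \<in> T" using assms(1) t by (simp add: eventually_nhds_in_open)
        ultimately have "\<forall>\<^sub>F s in nhds t. s \<in> T \<and> y s \<noteq> h" by eventually_elim simp
        then obtain d where d: "d > 0" "\<And>s. dist s t < d \<Longrightarrow> s \<in> T \<and> y s \<noteq> h"
          unfolding eventually_nhds_metric by blast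
        have "f t = f s" if "s \<in> ball t d" for s
          using d that by (intro DERIV_zero_const_on[of "ball t d"] der) (auto simp: dist_commute)
        then show ?thesis
          unfolding eventually_at using d False by (intro exI[of _ d]) (auto simp: g_def dist_commute)
      next
        case True
        have "\<forall>\<^sub>F s in at t. s \<in> T"
          using assms(1) t by (simp add: eventually_at_in_open')
        with iso[OF t True] have "\<forall>\<^sub>F s in at t. s \<in> T \<and> y s \<noteq> h" by eventually_elim simp
        then obtain d where d: "d > 0" "\<And>s. s \<noteq> t \<Longrightarrow> dist s t < d \<Longrightarrow> s \<in> T \<and> y s \<noteq> h"
          unfolding eventually_at by blast
        have der': "(f has_real_derivative 0) (at u)" if "u \<noteq> t" "dist u t < d" for u
          using der d(2)[OF that] by blast
        obtain l where l: "(f \<longlongrightarrow> l) (at_left t)" "(f \<longlongrightarrow> l) (at_right t)"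
          using lim[OF t True] by blast
        \<comment> \<open>On the hit-free interval just before \<open>t\<close> the function is
          constant, so each of its values equals the limit at the right end.\<close>
        have left: "f s = l" if s: "s \<in> {t - d<..<t}" for s
        proof -
          have "\<forall>\<^sub>F u in at_left t. u \<in> {t - d<..<t}"
            using d(1) by (intro eventually_at_left_real) simp
          then have "\<forall>\<^sub>F u in at_left t. f u = f s"
            by eventually_elim
              (rule DERIV_zero_const_on[where f = f and S = "{t - d<..<t}"], use s in \<open>auto intro!: der' simp: dist_real_def\<close>)
          then have "(f \<longlongrightarrow> f s) (at_left t)" by (rule tendsto_eventually)
          with l(1) show ?thesis by (intro tendsto_unique[of "at_left t" f]) auto
        qed
        have right: "f s = l" if s: "s \<in> {t<..<t + d}" for s
        proof -
          have "\<forall>\<^sub>F u in at_right t. u \<in> {t<..<t + d}"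
            using d(1) by (intro eventually_at_right_real) simp
          then have "\<forall>\<^sub>F u in at_right t. f u = f s"
            by eventually_elim
              (rule DERIV_zero_const_on[where f = f and S = "{t<..<t + d}"], use s in \<open>auto intro!: der' simp: dist_real_def\<close>)
          then have "(f \<longlongrightarrow> f s) (at_right t)" by (rule tendsto_eventually)
          with l(2) show ?thesis by (intro tendsto_unique[of "at_right t" f]) auto
        qed
        have "(f \<longlongrightarrow> l) (at t)" using l by (simp add: filterlim_split_at)
        then have "g t = l" using True by (simp add: g_def tendsto_Lim)
        moreover have "g s = l" if "s \<noteq> t" "dist s t < d" for s
        proof -
          have "s \<in> {t - d<..<t} \<or> s \<in> {t<..<t + d}"
            using that by (auto simp: dist_real_def)
          then show ?thesis using left right d(2)[OF that] by (auto simp: g_def)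
        qed
        ultimately show ?thesis
          unfolding eventually_at using d(1) by (intro exI[of _ d]) simp
      qed
      then show "\<forall>\<^sub>F s in at t within T. g t = g s"
        by (simp only: at_within_open[OF t assms(1)])
    qed
  qed (use st in \<open>auto simp: free_times_def\<close>)
  then show ?thesis using st by (auto simp: g_def free_times_def)
qed

section \<open>The centre of the current ellipse\<close>

lemma open_free_times: "open (free_times h T y)" if "open T" "continuous_on T y"
proof -
  have "free_times h T y = T \<inter> y -` (- {h})" by (auto simp: free_times_def)
  then show ?thesis using that by (simp add: continuous_open_preimage open_Compl)
qed

text \<open>Existence for the definite description follows from the conservation laws on the
  collision-free component. For uniqueness, two admissible centres have equal norm, so their
  difference is orthogonal to the whole arc. Such an arc is radial, and then the centre must point
  towards the particle.\<close>

lemma kepler_centre_eq_lrl: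
  assumes "\<alpha> > 0" "A < 0" and motion: "billiard_motion \<alpha> h T x y px py"
    and t: "t \<in> free_times h T y"
    and energy: "kepler_H \<alpha> (x t) (y t) (px t) (py t) = A / 2"
  shows "kepler_centre \<alpha> A h T x y px py t = (1 / A) *\<^sub>R lrl \<alpha> (x t) (y t) (px t) (py t)"
proof -
  define S where "S = connected_component_set (free_times h T y) t"
  define c where "c = (1 / A) *\<^sub>R lrl \<alpha> (x t) (y t) (px t) (py t)"
  define a where "a = angular_momentum (x t) (y t) (px t) (py t)"
  have S: "open S" "connected S" "t \<in> S" "S \<subseteq> free_times h T y"
    using motion t unfolding S_def billiard_motion_def
    by (auto intro!: open_connected_component open_free_times
        simp: connected_component_subset connected_component_in)
  have nz: "(x s, y s) \<noteq> (0, 0)" and ham: "hamilton_equations_at \<alpha> x y px py s" if "s \<in> S" for s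
    using motion S(4) that by (auto simp: billiard_motion_def free_times_def)
  note const = DERIV_zero_const_on[OF S(2,1) _ _ S(3)]
  have H: "kepler_H \<alpha> (x s) (y s) (px s) (py s) = A / 2" if "s \<in> S" for s
    using const[OF kepler_conserved(1)[OF nz ham] that] energy by simp
  have a: "angular_momentum (x s) (y s) (px s) (py s) = a" if "s \<in> S" for s
    using const[OF kepler_conserved(2)[OF nz ham] that] by (simp add: a_def)
  have lrl: "lrl \<alpha> (x s) (y s) (px s) (py s) = lrl \<alpha> (x t) (y t) (px t) (py t)" if "s \<in> S" for s
    using const[OF kepler_conserved(3)[OF nz ham] that] const[OF kepler_conserved(4)[OF nz ham] that]
    by (simp add: prod_eq_iff)
  have norm_c: "norm c = semi_major \<alpha> A * eccentricity \<alpha> A a"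
    unfolding c_def a_def using assms(1,2) nz[OF S(3)] energy by (rule norm_centre)
  have mem_c: "(x s, y s) \<in> ellipse_focus_origin (semi_major \<alpha> A) c" if "s \<in> S" for s
    using mem_kepler_ellipse[OF assms(1,2) nz[OF that] H[OF that]] by (simp add: lrl[OF that] c_def)
  have unique: "c' = c"
    if c': "norm c' = semi_major \<alpha> A * eccentricity \<alpha> A a"
      "\<forall>s\<in>S. (x s, y s) \<in> ellipse_focus_origin (semi_major \<alpha> A) c'" for c'
  proof (rule ccontr)
    assume "c' \<noteq> c"
    define u v where "u = fst (c - c')" and "v = snd (c - c')"
    have uv: "u \<noteq> 0 \<or> v \<noteq> 0" using \<open>c' \<noteq> c\<close> by (auto simp: u_def v_def prod_eq_iff)
    \<comment> \<open>Equal norms make all other terms of the two focal equations agree.\<close>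
    have perp: "(x s, y s) \<bullet> c' = (x s, y s) \<bullet> c" if "s \<in> S" for s
      using mem_c[OF that] bspec[OF c'(2) that] c'(1) norm_c
      unfolding ellipse_focus_origin_iff by simp
    then have line: "u * x s + v * y s = 0" if "s \<in> S" for s
      using that by (force simp: u_def v_def inner_prod_def algebra_simps)
    note D = hamilton_equations_derivs(1,2)[OF nz[OF S(3)] ham[OF S(3)]]
    have "((\<lambda>s. u * x s + v * y s) has_real_derivative u * px t + v * py t) (at t)"
      by (intro DERIV_add DERIV_cmult D)
    \<comment> \<open>The linear form vanishes on the open set \<open>S\<close> around
      \<open>t\<close>, so its derivative vanishes and the velocity satisfies the same linear
      relation as the position.\<close>
    moreover have "((\<lambda>s. u * x s + v * y s) has_real_derivative 0) (at t)"
      using has_field_derivative_transform_within_open[OF DERIV_const[of 0] S(1,3)] line by auto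
    ultimately have dline: "u * px t + v * py t = 0" by (rule DERIV_unique)
    txt \<open>The arc lies on a line through the origin, hence the motion is radial and the centre is
      determined by the position alone.\<close>
    have "u * a = 0" "v * a = 0"
      using line[OF S(3)] dline unfolding a_def angular_momentum_def by algebra+
    then have a0: "a = 0" using uv by auto
    have "norm c = semi_major \<alpha> A" using norm_c by (simp add: a0 eccentricity_def)
    moreover have "norm c' = semi_major \<alpha> A" using c'(1) by (simp add: a0 eccentricity_def)
    \<comment> \<open>For \<open>a = 0\<close> the eccentricity is 1 and the focal equation
      degenerates to equality in Cauchy-Schwarz; by \<open>perp\<close> the same holds for
      \<open>c'\<close>.\<close>
    moreover have "(x t, y t) \<bullet> c = norm (x t, y t) * semi_major \<alpha> A"
      using mem_c[OF S(3)] \<open>norm c = semi_major \<alpha> A\<close> unfolding ellipse_focus_origin_iff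
      by (simp add: mult.commute)
    ultimately have "norm (x t, y t) *\<^sub>R c = norm (x t, y t) *\<^sub>R c'"
      using perp[OF S(3)] norm_cauchy_schwarz_eq[of "(x t, y t)" c]
        norm_cauchy_schwarz_eq[of "(x t, y t)" c'] by metis
    then show False using nz[OF S(3)] \<open>c' \<noteq> c\<close> by (auto simp: zero_prod_def)
  qed
  show ?thesis
    unfolding kepler_centre_def S_def[symmetric] a_def[symmetric] c_def[symmetric]
    using norm_c mem_c unique by (intro the_equality conjI ballI) blast+
qed

section \<open>The constant of motion of the billiard\<close>

theorem theorem1:
  fixes \<alpha> A h t0 :: real and T :: "real set"
    and x y px py \<theta>0 a e R0 :: "real \<Rightarrow> real" and aM :: real
  assumes "\<alpha> > 0" and "A < 0"
    and motion: "billiard_motion \<alpha> h T x y px py"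
    and "t0 \<in> free_times h T y"
    and energy: "kepler_H \<alpha> (x t0) (y t0) (px t0) (py t0) = A / 2"
    and aphelion: "\<And>t. t \<in> free_times h T y \<Longrightarrow>
           is_aphelion_angle (kepler_ellipse \<alpha> A h T x y px py t) (\<theta>0 t)"
  defines "a \<equiv> \<lambda>t. angular_momentum (x t) (y t) (px t) (py t)"
    and "e \<equiv> \<lambda>t. eccentricity \<alpha> A (a t)"
    and "aM \<equiv> semi_major \<alpha> A"
    and "R0 \<equiv> \<lambda>t. dist (0, h) (kepler_centre \<alpha> A h T x y px py t)"
  shows "\<exists>R. \<forall>t \<in> free_times h T y.
           (a t)\<^sup>2 + h * \<alpha> * e t * sin (\<theta>0 t) = R \<and>
           \<alpha> / (2 * aM) * (h\<^sup>2 + aM\<^sup>2 - (R0 t)\<^sup>2) = R"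
proof -
  define E where "E = (\<lambda>t. kepler_H \<alpha> (x t) (y t) (px t) (py t))"
  define L where "L = (\<lambda>t. lrl \<alpha> (x t) (y t) (px t) (py t))"
  \<comment> \<open>\<open>F\<close> expresses both forms of \<open>R\<close> in phase-space
    variables, where one-sided limits at a hit can be taken. The term
    \<open>- 2 * h * snd (L t)\<close> is \<open>h * \<alpha> * e t * sin (\<theta>0 t)\<close>,
    since \<open>snd (L t)\<close> is \<open>A\<close> times the second coordinate of the
    centre.\<close>
  define F where "F = (\<lambda>t. (a t)\<^sup>2 - 2 * h * snd (L t))"
  have T: "open T" "is_interval T" "continuous_on T x" "continuous_on T y"
    and nz: "\<And>t. t \<in> T \<Longrightarrow> (x t, y t) \<noteq> (0, 0)"
    and ham: "\<And>t. t \<in> T \<Longrightarrow> y t \<noteq> h \<Longrightarrow> hamilton_equations_at \<alpha> x y px py t"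
    and iso: "\<And>t. t \<in> T \<Longrightarrow> y t = h \<Longrightarrow> \<forall>\<^sub>F s in at t. y s \<noteq> h"
    and mom: "\<And>t. t \<in> T \<Longrightarrow> y t = h \<Longrightarrow>
        \<exists>mx my. (px \<longlongrightarrow> mx) (at_left t) \<and> (px \<longlongrightarrow> mx) (at_right t) \<and>
                (py \<longlongrightarrow> my) (at_left t) \<and> (py \<longlongrightarrow> - my) (at_right t)"
    using motion by (auto simp: billiard_motion_def)
  \<comment> \<open>The set \<open>S\<close> is left free, so the same limits serve the left side
    with \<open>my\<close> and the right side with \<open>- my\<close>.\<close>
  have E_lim: "(E \<longlongrightarrow> kepler_H \<alpha> (x t) h mx my) (at t within S)"
    and F_lim: "(F \<longlongrightarrow> (x t)\<^sup>2 * my\<^sup>2 - h\<^sup>2 * mx\<^sup>2 + \<alpha> * h\<^sup>2 / sqrt ((x t)\<^sup>2 + h\<^sup>2)) (at t within S)"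
    if t: "t \<in> T" "y t = h" and m: "(px \<longlongrightarrow> mx) (at t within S)" "(py \<longlongrightarrow> my) (at t within S)"
    for t mx my S
  proof -
    have "isCont x t" "isCont y t"
      using T t(1) continuous_on_eq_continuous_at by blast+
    then have xy: "(x \<longlongrightarrow> x t) (at t within S)" "(y \<longlongrightarrow> h) (at t within S)"
      using t(2) by (auto simp: isCont_def intro: tendsto_within_subset)
    have pos: "sqrt ((x t)\<^sup>2 + h\<^sup>2) \<noteq> 0"
      using nz[OF t(1)] t(2) by (auto)
    show "(E \<longlongrightarrow> kepler_H \<alpha> (x t) h mx my) (at t within S)"
      unfolding E_def kepler_H_def using pos by (intro tendsto_intros xy m) auto
    have "(F \<longlongrightarrow> (x t * my - h * mx)\<^sup>2
        - 2 * h * (- mx * (x t * my - h * mx) - \<alpha> / 2 * h / sqrt ((x t)\<^sup>2 + h\<^sup>2))) (at t within S)"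
      unfolding F_def L_def a_def lrl_def snd_conv angular_momentum_def
      using pos by (intro tendsto_intros xy m) auto
    \<comment> \<open>The mixed terms in \<open>mx * my\<close>, the only ones odd in
      \<open>my\<close>, cancel because the height of the particle equals the \<open>h\<close> in
      \<open>F\<close>.\<close>
    also have "(x t * my - h * mx)\<^sup>2
        - 2 * h * (- mx * (x t * my - h * mx) - \<alpha> / 2 * h / sqrt ((x t)\<^sup>2 + h\<^sup>2))
      = (x t)\<^sup>2 * my\<^sup>2 - h\<^sup>2 * mx\<^sup>2 + \<alpha> * h\<^sup>2 / sqrt ((x t)\<^sup>2 + h\<^sup>2)"
      by (simp add: power2_eq_square algebra_simps)
    finally show "(F \<longlongrightarrow> (x t)\<^sup>2 * my\<^sup>2 - h\<^sup>2 * mx\<^sup>2 + \<alpha> * h\<^sup>2 / sqrt ((x t)\<^sup>2 + h\<^sup>2)) (at t within S)" .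
  qed
  \<comment> \<open>The energy is prescribed at \<open>t0\<close> only; a reflection changes just
    the sign of \<open>py\<close>, so the value carries over to every other arc.\<close>
  have E_const: "E t = E t0" if "t \<in> free_times h T y" for t
  proof (rule const_across_isolated[where f = E and h = h and y = y and T = T])
    show "(E has_real_derivative 0) (at t)" if "t \<in> T" "y t \<noteq> h" for t
      unfolding E_def by (rule kepler_conserved(1)[OF nz[OF that(1)] ham[OF that]])
    show "\<exists>l. (E \<longlongrightarrow> l) (at_left t) \<and> (E \<longlongrightarrow> l) (at_right t)" if t: "t \<in> T" "y t = h" for t
    proof -
      obtain mx my where m: "(px \<longlongrightarrow> mx) (at_left t)" "(px \<longlongrightarrow> mx) (at_right t)"
        "(py \<longlongrightarrow> my) (at_left t)" "(py \<longlongrightarrow> - my) (at_right t)"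
        using mom[OF t] by blast
      have "kepler_H \<alpha> (x t) h mx (- my) = kepler_H \<alpha> (x t) h mx my"
        by (simp add: kepler_H_def)
      then show ?thesis using E_lim[OF t m(1,3)] E_lim[OF t m(2,4)] by auto
    qed
  qed (use that assms(4) T iso in auto)
  have F_const: "F t = F t0" if "t \<in> free_times h T y" for t
  proof (rule const_across_isolated[where f = F and h = h and y = y and T = T])
    show "(F has_real_derivative 0) (at t)" if "t \<in> T" "y t \<noteq> h" for t
    proof -
      note D = kepler_conserved(2,4)[OF nz[OF that(1)] ham[OF that]]
      show ?thesis
        unfolding F_def L_def a_def
        by (rule DERIV_cong[OF DERIV_diff[OF DERIV_power[OF D(1)] DERIV_cmult[OF D(2)]]]) simp
    qed
    show "\<exists>l. (F \<longlongrightarrow> l) (at_left t) \<and> (F \<longlongrightarrow> l) (at_right t)" if t: "t \<in> T" "y t = h" for t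
    proof -
      obtain mx my where m: "(px \<longlongrightarrow> mx) (at_left t)" "(px \<longlongrightarrow> mx) (at_right t)"
        "(py \<longlongrightarrow> my) (at_left t)" "(py \<longlongrightarrow> - my) (at_right t)"
        using mom[OF t] by blast
      show ?thesis using F_lim[OF t m(1,3)] F_lim[OF t m(2,4)] by auto
    qed
  qed (use that assms(4) T iso in auto)
  have aM: "aM > 0" and aM_eq: "aM = - \<alpha> / (2 * A)"
    using assms(1,2) by (simp_all add: aM_def semi_major_def divide_pos_neg)
  have "(a t)\<^sup>2 + h * \<alpha> * e t * sin (\<theta>0 t) = F t \<and>
        \<alpha> / (2 * aM) * (h\<^sup>2 + aM\<^sup>2 - (R0 t)\<^sup>2) = F t" if t: "t \<in> free_times h T y" for t
  proof
    have tT: "t \<in> T" using t by (simp add: free_times_def)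
    have H: "kepler_H \<alpha> (x t) (y t) (px t) (py t) = A / 2"
      using E_const[OF t] energy by (simp add: E_def)
    define c where "c = (1 / A) *\<^sub>R L t"
    have centre: "kepler_centre \<alpha> A h T x y px py t = c"
      unfolding c_def L_def by (rule kepler_centre_eq_lrl[OF assms(1,2) motion t H])
    have norm_c: "norm c = aM * e t"
      unfolding c_def L_def aM_def e_def a_def
      by (rule norm_centre[OF assms(1,2) nz[OF tT] H])
    have diff: "aM\<^sup>2 - (norm c)\<^sup>2 = - (a t)\<^sup>2 / A"
      unfolding c_def L_def aM_def a_def
      by (rule semi_major_power_diff[OF assms(2) nz[OF tT] H])
    \<comment> \<open>The origin is inside the ellipse or on its degenerate segment, as
      \<open>aphelion_angle_centre\<close> requires.\<close>
    have "norm c \<le> aM"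
      unfolding norm_c e_def using aM eccentricity_le_1[OF assms(2)] by (simp add: mult_left_le)
    moreover have "is_aphelion_angle (ellipse_focus_origin aM c) (\<theta>0 t)"
      using aphelion[OF t] by (simp add: kepler_ellipse_def centre aM_def)
    ultimately have "c = norm c *\<^sub>R (cos (\<theta>0 t), sin (\<theta>0 t))"
      by (rule aphelion_angle_centre)
    then have "snd c = norm c * sin (\<theta>0 t)" by (metis snd_conv snd_scaleR real_scaleR_def)
    then have sin: "snd c = aM * e t * sin (\<theta>0 t)" by (simp add: norm_c)
    have F: "F t = (a t)\<^sup>2 - 2 * h * A * snd c"
      using assms(2) by (simp add: F_def c_def)
    show "(a t)\<^sup>2 + h * \<alpha> * e t * sin (\<theta>0 t) = F t"
      unfolding F sin aM_eq using assms(2) by simp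
    \<comment> \<open>Law of cosines for the triangle formed by the origin, \<open>(0, h)\<close>
      and the centre.\<close>
    have "(R0 t)\<^sup>2 = h\<^sup>2 - 2 * h * snd c + (norm c)\<^sup>2"
      unfolding R0_def centre
      by (cases c) (simp add: dist_norm power2_norm_eq_inner, simp add: power2_eq_square algebra_simps)
    then have "h\<^sup>2 + aM\<^sup>2 - (R0 t)\<^sup>2 = - (a t)\<^sup>2 / A + 2 * h * snd c"
      using diff by simp
    moreover have "\<alpha> / (2 * aM) = - A" using assms(1,2) by (simp add: aM_eq)
    ultimately show "\<alpha> / (2 * aM) * (h\<^sup>2 + aM\<^sup>2 - (R0 t)\<^sup>2) = F t"
      unfolding F using assms(2) by (simp add: field_simps)
  qed
  then show ?thesis using F_const by auto
qed

end
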